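(* Let $k>0$, $M\ge0$, $\epsilon>0$, and assume $\|f\|_{H^{2k}(0,\pi)}\le M$, $\|g_\epsilon-g\|\le\epsilon$ and $\|\varphi_\epsilon-\varphi\|_{L^2[0,T]}\le\epsilon$, and that there exists $\tau>1$ such that $0<\tau\epsilon<\|g_\epsilon\|$. Let $\mu>0$ be the unique regularization parameter such that $\|Kf_\mu^\epsilon-g_\epsilon\|=\tau\epsilon$. Then $$\|f-f_\mu^\epsilon\|\le\begin{cases}\epsilon^{\frac{k}{k+1}}P, & 0<k\le1,\\ \epsilon^{\frac12}Q, & k>1,\end{cases}$$ where the constants $P$ and $Q$ depend on $T,\mu,k,\tau,B_1,B_2,C_1,C_2,D_1,D_2$ and $M$.
   Context: Let $T>0$ and let $a,\varphi,\varphi_\epsilon:[0,T]\to\mathbb{R}$ be continuous with constants $B_1,B_2,C_1,C_2,D_1,D_2>0$ such that $B_1\le\varphi(t)\le B_2$, $C_1\le\varphi_\epsilon(t)\le C_2$ and $D_1\le a(t)\le D_2$ for all $t\in[0,T]$. $\|\cdot\|$ and $\langle\cdot,\cdot\rangle$ are the norm and inner product of $L^2(0,\pi)$, and $X_n(x)=\sqrt{2/\pi}\,\sin(nx)$, $n=1,2,\dots$, is the orthonormal basis of $L^2(0,\pi)$. Put $A(t)=\int_0^t a(s)\,ds$, $B(t)=A(t)-A(T)$ and $\Phi(n,h)=\int_0^T e^{n^2B(t)}h(t)\,dt$. Inverse source problem: $f$ is the source term in $u_t-(a(t)u_x)_x=\varphi(t)f(x)$ on $(0,\pi)\times(0,T)$,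 with $u(x,0)=0$, $u(x,T)=g(x)$, $u(0,t)=u(\pi,t)=0$. Solving by Fourier sine series, this means that $f,g\in L^2(0,\pi)$ are related by $\langle g,X_n\rangle=\Phi(n,\varphi)\langle f,X_n\rangle$ for all $n\ge1$. The noisy data are $g_\epsilon\in L^2(0,\pi)$ and $\varphi_\epsilon$. For $s\ge0$, $\|f\|_{H^s(0,\pi)}=\big(\sum_{n\ge1}(1+n^2)^s\langle f,X_n\rangle^2\big)^{1/2}$. For $\mu>0$ the Tikhonov regularized solution from noisy data is $$f_\mu^\epsilon=\sum_{n=1}^\infty\frac{\Phi(n,\varphi_\epsilon)}{\mu^2+\Phi(n,\varphi_\epsilon)^2}\langle g_\epsilon,X_n\rangle X_n.$$ $K:L^2(0,\pi)\to L^2(0,\pi)$ is the operator $Kv=\sum_{n\ge1}\Phi(n,\varphi_\epsilon)\langle v,X_n\rangle X_n$, so that $\|Kf_\mu^\epsilon-g_\epsilon\|^2=\sum_{n\ge1}\left(\frac{\mu^2}{\mu^2+\Phi(n,\varphi_\epsilon)^2}\right)^2\langle g_\epsilon,X_n\rangle^2$. The equation $\|Kf_\mu^\epsilon-g_\epsilon\|=\tau\epsilon$ has exactly one solution $\mu>0$ whenever $0<\tau\epsilon<\|g_\epsilon\|$. *)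

theory Defs
  imports "HOL-Analysis.Analysis"
begin

text \<open>
  Elements of $L^2(S)$ are represented by functions; functions that agree almost everywhere on
  \<open>S\<close> stand for the same element, and all notions below only depend on that element.
\<close>

definition L2 :: "real set \<Rightarrow> (real \<Rightarrow> real) set" where
  "L2 S = {f \<in> borel_measurable (lebesgue_on S). integrable (lebesgue_on S) (\<lambda>x. (f x)\<^sup>2)}"

definition L2_norm :: "real set \<Rightarrow> (real \<Rightarrow> real) \<Rightarrow> real" where
  "L2_norm S f = sqrt (\<integral>x. (f x)\<^sup>2 \<partial>lebesgue_on S)"

definition L2_inner :: "real set \<Rightarrow> (real \<Rightarrow> real) \<Rightarrow> (real \<Rightarrow> real) \<Rightarrow> real" where
  "L2_inner S f g = (\<integral>x. f x * g x \<partial>lebesgue_on S)"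

abbreviation I\<^sub>\<pi> :: "real set" where
  "I\<^sub>\<pi> \<equiv> {0<..<pi}"

definition X :: "nat \<Rightarrow> real \<Rightarrow> real" where
  "X n x = sqrt (2 / pi) * sin (real n * x)"

definition coef :: "(real \<Rightarrow> real) \<Rightarrow> nat \<Rightarrow> real" where
  "coef f n = L2_inner I\<^sub>\<pi> f (X n)"

text \<open>
  \<open>sine_series c\<close> is the sum of $\sum_{n \ge 1} c_n X_n$ in the sense of convergence in
  $L^2(0,\pi)$: a representative of the limit of the partial sums. Whenever \<open>c\<close> is square
  summable such a limit exists and it is unique up to a null set.
\<close>

definition sine_series :: "(nat \<Rightarrow> real) \<Rightarrow> real \<Rightarrow> real" where
  "sine_series c = (SOME h. h \<in> L2 I\<^sub>\<pi> \<and>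
     (\<lambda>N. L2_norm I\<^sub>\<pi> (\<lambda>x. h x - (\<Sum>n = 1..N. c n * X n x))) \<longlonglongrightarrow> 0)"

text \<open>
  Since \<^term>\<open>infsum\<close> is \<open>0\<close> for a divergent sum, a bound on \<open>Hs_norm s f\<close> only means
  $\|f\|_{H^s(0,\pi)} \le M$ together with \<open>in_Hs s f\<close>.
\<close>

definition in_Hs :: "real \<Rightarrow> (real \<Rightarrow> real) \<Rightarrow> bool" where
  "in_Hs s f \<longleftrightarrow> f \<in> L2 I\<^sub>\<pi> \<and>
     (\<lambda>n. (1 + (real n)\<^sup>2) powr s * (coef f n)\<^sup>2) summable_on {1..}"

definition Hs_norm :: "real \<Rightarrow> (real \<Rightarrow> real) \<Rightarrow> real" where
  "Hs_norm s f = sqrt (\<Sum>\<^sub>\<infinity>n\<in>{1..}. (1 + (real n)\<^sup>2) powr s * (coef f n)\<^sup>2)"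

definition A :: "(real \<Rightarrow> real) \<Rightarrow> real \<Rightarrow> real" where
  "A a t = integral {0..t} a"

definition B :: "real \<Rightarrow> (real \<Rightarrow> real) \<Rightarrow> real \<Rightarrow> real" where
  "B T a t = A a t - A a T"

definition Phi :: "real \<Rightarrow> (real \<Rightarrow> real) \<Rightarrow> nat \<Rightarrow> (real \<Rightarrow> real) \<Rightarrow> real" where
  "Phi T a n h = integral {0..T} (\<lambda>t. exp ((real n)\<^sup>2 * B T a t) * h t)"

text \<open>
  The source \<open>f\<close> and the final value \<open>g = u(\<cdot>,T)\<close> of
  $u_t - (a(t) u_x)_x = \varphi(t) f(x)$ with zero initial and boundary values, related through
  the solution by Fourier sine series.
\<close>

definition source_of :: "real \<Rightarrow> (real \<Rightarrow> real) \<Rightarrow> (real \<Rightarrow> real) \<Rightarrow> (real \<Rightarrow> real) \<Rightarrow> (real \<Rightarrow> real) \<Rightarrow> bool"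
  where "source_of T a \<phi> f g \<longleftrightarrow> f \<in> L2 I\<^sub>\<pi> \<and> g \<in> L2 I\<^sub>\<pi> \<and>
     (\<forall>n\<ge>1. coef g n = Phi T a n \<phi> * coef f n)"

definition K :: "real \<Rightarrow> (real \<Rightarrow> real) \<Rightarrow> (real \<Rightarrow> real) \<Rightarrow> (real \<Rightarrow> real) \<Rightarrow> real \<Rightarrow> real" where
  "K T a \<phi>\<^sub>\<epsilon> v = sine_series (\<lambda>n. Phi T a n \<phi>\<^sub>\<epsilon> * coef v n)"

definition tikhonov ::
  "real \<Rightarrow> (real \<Rightarrow> real) \<Rightarrow> (real \<Rightarrow> real) \<Rightarrow> (real \<Rightarrow> real) \<Rightarrow> real \<Rightarrow> real \<Rightarrow> real" where
  "tikhonov T a \<phi>\<^sub>\<epsilon> g\<^sub>\<epsilon> \<mu> =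
     sine_series (\<lambda>n. Phi T a n \<phi>\<^sub>\<epsilon> / (\<mu>\<^sup>2 + (Phi T a n \<phi>\<^sub>\<epsilon>)\<^sup>2) * coef g\<^sub>\<epsilon> n)"

end

theory Submission
  imports Defs
begin

text \<open>
  The parameter \<open>\<mu>\<close> is fixed while the data vary, and the constants may depend on it. The
  residual of the regularized solution has coefficients
  $\frac{\mu^2}{\mu^2+\Phi(n,\varphi_\epsilon)^2}\langle g_\epsilon,X_n\rangle$ up to sign, and for
  fixed \<open>\<mu>\<close> this multiplier is bounded below, because $\Phi(n,\varphi_\epsilon)$ is bounded. Hence
  the discrepancy equation forces the data themselves to be small:
  $\|g_\epsilon\| \le R\tau\epsilon$ with $R = 1 + (C_2/(D_1\mu))^2$ (\<open>data_norm_le_residual\<close>), and therefore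
  $\|g\| \le (R\tau+1)\epsilon$. The error is now estimated by
  $\|f\| + \|f_\mu^\epsilon\|$, with no cancellation between the two.

  The regularized solution is bounded by $\|g_\epsilon\|/(2\mu)$ (\<open>tikhonov_norm_le\<close>), so it is
  of order $\epsilon$. For \<open>f\<close>, the multiplier $\Phi(n,\varphi)$ is bounded below by a multiple of
  $n^{-2}$ (\<open>Phi_bounds\<close>), so \<open>g\<close> controls a negative norm of \<open>f\<close>, and interpolation with the
  Sobolev bound (\<open>L2_norm_interpolation\<close>) gives $\|f\| \le C\epsilon^{k/(k+1)}$.

  What remains is to compare powers of $\epsilon$. The hypothesis
  $\tau\epsilon < \|g_\epsilon\| \le \|g\| + \epsilon$ with \<open>\<tau> > 1\<close> bounds $\epsilon$ by a constant
  multiple of $\|g\|$, hence of \<open>M\<close>; on a bounded range of $\epsilon$ the powers $\epsilon$ and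
  $\epsilon^{k/(k+1)}$ are at most constant multiples of lower powers, such as
  $\epsilon^{1/2}$ when \<open>k > 1\<close>.

  All norms are compared through sine coefficients, which rests on Parseval's identity
  (\<open>parseval\<close>), that is, on the completeness of the sine system in $L^2(0,\pi)$.
\<close>

section \<open>Square integrable functions\<close>

lemma L2_mult_integrable:
  assumes "f \<in> L2 S" "g \<in> L2 S"
  shows "integrable (lebesgue_on S) (\<lambda>x. f x * g x)"
proof (rule Bochner_Integration.integrable_bound)
  show "integrable (lebesgue_on S) (\<lambda>x. (f x)\<^sup>2 + (g x)\<^sup>2)"
    using assms by (auto simp: L2_def)
  show "(\<lambda>x. f x * g x) \<in> borel_measurable (lebesgue_on S)"
    using assms by (auto simp: L2_def)
  have "\<bar>f x * g x\<bar> \<le> (f x)\<^sup>2 + (g x)\<^sup>2" for x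
  proof -
    have "2 * \<bar>f x * g x\<bar> \<le> (f x)\<^sup>2 + (g x)\<^sup>2"
      using sum_squares_bound[of "\<bar>f x\<bar>" "\<bar>g x\<bar>"] by (simp add: abs_mult)
    then show ?thesis using abs_ge_zero[of "f x * g x"] by linarith
  qed
  then show "AE x in lebesgue_on S. norm (f x * g x) \<le> norm ((f x)\<^sup>2 + (g x)\<^sup>2)"
    by simp
qed

lemma L2_add: "f \<in> L2 S \<Longrightarrow> g \<in> L2 S \<Longrightarrow> (\<lambda>x. f x + g x) \<in> L2 S"
  using L2_mult_integrable[of f S g] by (auto simp: L2_def power2_sum mult.assoc)

lemma L2_scale: "f \<in> L2 S \<Longrightarrow> (\<lambda>x. c * f x) \<in> L2 S"
  by (auto simp: L2_def power_mult_distrib)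

lemma L2_diff: "f \<in> L2 S \<Longrightarrow> g \<in> L2 S \<Longrightarrow> (\<lambda>x. f x - g x) \<in> L2 S"
  using L2_add[OF _ L2_scale[of g S "-1"], of f] by simp

lemma L2_sum: "(\<And>i. i \<in> F \<Longrightarrow> u i \<in> L2 S) \<Longrightarrow> (\<lambda>x. \<Sum>i\<in>F. u i x) \<in> L2 S"
proof (induction F rule: infinite_finite_induct)
  case (insert i F)
  then show ?case by (simp add: L2_add)
qed (auto simp: L2_def)

lemma L2_norm_nonneg: "0 \<le> L2_norm S f"
  by (simp add: L2_norm_def)

lemma L2_norm_sq: "(L2_norm S f)\<^sup>2 = L2_inner S f f"
  by (simp add: L2_norm_def L2_inner_def power2_eq_square)

lemma L2_norm_le_square: "(L2_norm S f)\<^sup>2 \<le> b\<^sup>2 \<Longrightarrow> 0 \<le> b \<Longrightarrow> L2_norm S f \<le> b"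
  by (rule power2_le_imp_le)

lemma L2_inner_commute: "L2_inner S f g = L2_inner S g f"
  by (simp add: L2_inner_def mult.commute)

lemma L2_inner_diff_left:
  "f \<in> L2 S \<Longrightarrow> g \<in> L2 S \<Longrightarrow> h \<in> L2 S \<Longrightarrow>
    L2_inner S (\<lambda>x. f x - g x) h = L2_inner S f h - L2_inner S g h"
  by (simp add: L2_inner_def left_diff_distrib L2_mult_integrable)

lemma L2_inner_sum_left:
  assumes "\<And>i. i \<in> F \<Longrightarrow> u i \<in> L2 S" "h \<in> L2 S"
  shows "L2_inner S (\<lambda>x. \<Sum>i\<in>F. c i * u i x) h = (\<Sum>i\<in>F. c i * L2_inner S (u i) h)"
proof -
  have "integrable (lebesgue_on S) (\<lambda>x. c i * u i x * h x)" if "i \<in> F" for i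
    using L2_mult_integrable[OF L2_scale[OF assms(1)[OF that], of "c i"] assms(2)]
    by (simp add: mult.assoc)
  then show ?thesis
    by (simp add: L2_inner_def sum_distrib_right mult.assoc)
qed

text \<open>
  For weights \<open>s, t > 0\<close>, convexity of the square gives
  $(f+g)^2 \le (s+t)(f^2/s + g^2/t)$. Taking \<open>s\<close> and \<open>t\<close> slightly larger than the two norms avoids
  a case distinction on vanishing norms.
\<close>

lemma L2_norm_triangle:
  assumes f: "f \<in> L2 S" and g: "g \<in> L2 S"
  shows "L2_norm S (\<lambda>x. f x + g x) \<le> L2_norm S f + L2_norm S g"
proof (rule field_le_epsilon)
  fix e :: real assume e: "0 < e"
  define p q where "p = L2_norm S f" and "q = L2_norm S g"
  define s t where "s = p + e / 2" and "t = q + e / 2"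
  have pq: "0 \<le> p" "0 \<le> q"
    by (auto simp: p_def q_def L2_norm_nonneg)
  then have st: "s > 0" "t > 0" using e by (auto simp: s_def t_def)
  have pt: "(u + v)\<^sup>2 \<le> (s + t) / s * u\<^sup>2 + (s + t) / t * v\<^sup>2" for u v :: real
  proof -
    have "0 \<le> (t * u - s * v)\<^sup>2 / (s * t)" using st by simp
    also have "\<dots> = (s + t) / s * u\<^sup>2 + (s + t) / t * v\<^sup>2 - (u + v)\<^sup>2"
      using st by (simp add: field_simps power2_eq_square)
    finally show ?thesis by simp
  qed
  have I: "integrable (lebesgue_on S) (\<lambda>x. (f x)\<^sup>2)" "integrable (lebesgue_on S) (\<lambda>x. (g x)\<^sup>2)"
    using f g by (auto simp: L2_def)
  have N: "(L2_norm S h)\<^sup>2 = (\<integral>x. (h x)\<^sup>2 \<partial>lebesgue_on S)" for h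
    by (simp add: L2_norm_def)
  have "(L2_norm S (\<lambda>x. f x + g x))\<^sup>2
      \<le> (\<integral>x. (s + t) / s * (f x)\<^sup>2 + (s + t) / t * (g x)\<^sup>2 \<partial>lebesgue_on S)"
    unfolding N using I L2_add[OF f g]
    by (intro integral_mono pt) (auto simp: L2_def)
  also have "\<dots> = (s + t) / s * p\<^sup>2 + (s + t) / t * q\<^sup>2"
    using I by (simp add: p_def q_def N)
  also have "\<dots> \<le> (s + t) / s * s\<^sup>2 + (s + t) / t * t\<^sup>2"
    using st pq e by (intro add_mono mult_left_mono power_mono) (auto simp: s_def t_def)
  also have "\<dots> = (s + t)\<^sup>2"
    using st by (simp add: field_simps power2_eq_square)
  finally have "L2_norm S (\<lambda>x. f x + g x) \<le> s + t"
    using st by (intro L2_norm_le_square) auto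
  then show "L2_norm S (\<lambda>x. f x + g x) \<le> L2_norm S f + L2_norm S g + e"
    by (simp add: s_def t_def p_def q_def)
qed

lemma L2_norm_triangle_diff:
  assumes "f \<in> L2 S" "g \<in> L2 S"
  shows "L2_norm S (\<lambda>x. f x - g x) \<le> L2_norm S f + L2_norm S g"
  using L2_norm_triangle[OF assms(1) L2_scale[OF assms(2), of "-1"]]
  by (simp add: L2_norm_def)

lemma L2_norm_triangle_between:
  assumes "f \<in> L2 S" "g \<in> L2 S" "h \<in> L2 S"
  shows "L2_norm S (\<lambda>x. f x - h x) \<le> L2_norm S (\<lambda>x. f x - g x) + L2_norm S (\<lambda>x. g x - h x)"
  using L2_norm_triangle[OF L2_diff[OF assms(1,2)] L2_diff[OF assms(2,3)]] by simp

lemma L2_norm_dominated_convergence: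
  assumes u: "\<And>j. u j \<in> borel_measurable (lebesgue_on S)" and f: "f \<in> borel_measurable (lebesgue_on S)"
    and w: "w \<in> L2 S" and bd: "\<And>j x. x \<in> S \<Longrightarrow> \<bar>f x - u j x\<bar> \<le> w x"
    and lim: "AE x in lebesgue_on S. (\<lambda>j. u j x) \<longlonglongrightarrow> f x"
  shows "(\<lambda>j. L2_norm S (\<lambda>x. f x - u j x)) \<longlonglongrightarrow> 0"
proof -
  have "(\<lambda>j. \<integral>x. (f x - u j x)\<^sup>2 \<partial>lebesgue_on S) \<longlonglongrightarrow> (\<integral>x. 0 \<partial>lebesgue_on S)"
  proof (rule integral_dominated_convergence[where w="\<lambda>x. (w x)\<^sup>2"])
    show "integrable (lebesgue_on S) (\<lambda>x. (w x)\<^sup>2)" using w by (simp add: L2_def)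
    show "AE x in lebesgue_on S. (\<lambda>j. (f x - u j x)\<^sup>2) \<longlonglongrightarrow> 0"
      using lim
    proof eventually_elim
      case (elim x)
      then have "(\<lambda>j. (f x - u j x)\<^sup>2) \<longlonglongrightarrow> (f x - f x)\<^sup>2" by (intro tendsto_intros)
      then show ?case by simp
    qed
    show "AE x in lebesgue_on S. norm ((f x - u j x)\<^sup>2) \<le> (w x)\<^sup>2" for j
      using bd[of _ j] by (intro AE_I2) (auto intro!: abs_le_square_iff[THEN iffD1] order_trans[OF bd abs_ge_self])
  qed (use u f in auto)
  then have "(\<lambda>j. sqrt (\<integral>x. (f x - u j x)\<^sup>2 \<partial>lebesgue_on S)) \<longlonglongrightarrow> sqrt 0"
    by (intro tendsto_real_sqrt) simp
  then show ?thesis by (simp add: L2_norm_def)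
qed

lemma finite_measure_I_pi: "finite_measure (lebesgue_on I\<^sub>\<pi>)"
  by (rule finite_measure_lebesgue_on) (simp add: bounded_set_imp_lmeasurable)

lemma L2_bounded:
  assumes "f \<in> borel_measurable (lebesgue_on I\<^sub>\<pi>)" "\<And>x. x \<in> I\<^sub>\<pi> \<Longrightarrow> \<bar>f x\<bar> \<le> b"
  shows "f \<in> L2 I\<^sub>\<pi>"
proof -
  have "integrable (lebesgue_on I\<^sub>\<pi>) (\<lambda>x. (f x)\<^sup>2)"
    using assms abs_le_square_iff[of "f _" b]
    by (intro finite_measure.integrable_const_bound[OF finite_measure_I_pi, of _ "b\<^sup>2"] AE_I2)
       (auto intro!: abs_le_square_iff[THEN iffD1] order_trans[OF assms(2) abs_ge_self])
  then show ?thesis using assms by (simp add: L2_def)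
qed

lemma L2_norm_bounded:
  assumes "f \<in> borel_measurable (lebesgue_on I\<^sub>\<pi>)" "\<And>x. x \<in> I\<^sub>\<pi> \<Longrightarrow> \<bar>f x\<bar> \<le> b" "0 \<le> b"
  shows "L2_norm I\<^sub>\<pi> f \<le> sqrt pi * b"
proof -
  have "(\<integral>x. (f x)\<^sup>2 \<partial>lebesgue_on I\<^sub>\<pi>) \<le> (\<integral>x. b\<^sup>2 \<partial>lebesgue_on I\<^sub>\<pi>)"
    using L2_bounded[OF assms(1,2)] finite_measure.integrable_const[OF finite_measure_I_pi]
    by (intro integral_mono) (auto simp: L2_def intro!: abs_le_square_iff[THEN iffD1] order_trans[OF assms(2) abs_ge_self])
  also have "\<dots> = pi * b\<^sup>2"
    by (simp add: measure_restrict_space)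
  finally have "(L2_norm I\<^sub>\<pi> f)\<^sup>2 \<le> (sqrt pi * b)\<^sup>2"
    by (simp add: L2_norm_def power_mult_distrib)
  then show ?thesis using assms(3) by (intro L2_norm_le_square) auto
qed

section \<open>Orthonormality of the sine system\<close>

lemma X_measurable [measurable]: "X n \<in> borel_measurable (lebesgue_on I\<^sub>\<pi>)"
  unfolding X_def [abs_def]
  by (intro continuous_imp_measurable_on_sets_lebesgue continuous_intros) auto

lemma X_bound: "\<bar>X n x\<bar> \<le> 1"
proof -
  have "sqrt (2 / pi) \<le> 1" using pi_ge_two by simp
  then have "sqrt (2 / pi) * \<bar>sin (real n * x)\<bar> \<le> 1 * 1"
    by (intro mult_mono) auto
  then show ?thesis by (simp add: X_def abs_mult)
qed

lemma X_in_L2: "X n \<in> L2 I\<^sub>\<pi>"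
  by (rule L2_bounded[OF X_measurable X_bound])

lemma sine_sum_in_L2: "(\<lambda>x. \<Sum>n\<in>F. c n * X n x) \<in> L2 I\<^sub>\<pi>"
  by (intro L2_sum L2_scale X_in_L2)

lemma cos_integral:
  "integrable (lebesgue_on I\<^sub>\<pi>) (\<lambda>x. cos (of_int j * x))"
  "(\<integral>x. cos (of_int j * x) \<partial>lebesgue_on I\<^sub>\<pi>) = (if j = 0 then pi else 0)"
proof -
  show I: "integrable (lebesgue_on I\<^sub>\<pi>) (\<lambda>x. cos (of_int j * x))"
    by (intro finite_measure.integrable_const_bound[OF finite_measure_I_pi, of _ 1] AE_I2
        continuous_imp_measurable_on_sets_lebesgue continuous_intros) auto
  have "((\<lambda>x. cos (of_int j * x)) has_integral (if j = 0 then pi else 0)) {0..pi}"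
  proof (cases "j = 0")
    case True
    then show ?thesis using has_integral_const_real[of "1::real" 0 pi] by simp
  next
    case False
    have "((\<lambda>x. cos (of_int j * x)) has_integral
        sin (of_int j * pi) / of_int j - sin (of_int j * 0) / of_int j) {0..pi}"
      using False
      by (intro fundamental_theorem_of_calculus)
         (auto intro!: derivative_eq_intros simp flip: has_real_derivative_iff_has_vector_derivative)
    moreover have "sin (of_int j * pi) = 0"
      using sin_zero_iff_int2 by blast
    ultimately show ?thesis using False by simp
  qed
  then have J: "((\<lambda>x. cos (of_int j * x)) has_integral (if j = 0 then pi else 0)) I\<^sub>\<pi>"
    by (simp only: has_integral_Icc_iff_Ioo)
  have "((\<lambda>x. cos (of_int j * x)) has_integral
      (\<integral>x. cos (of_int j * x) \<partial>lebesgue_on I\<^sub>\<pi>)) I\<^sub>\<pi>"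
    by (rule has_integral_integral_lebesgue_on[OF I]) simp
  then show "(\<integral>x. cos (of_int j * x) \<partial>lebesgue_on I\<^sub>\<pi>) = (if j = 0 then pi else 0)"
    using J by (rule has_integral_unique)
qed

lemma X_orthonormal:
  assumes "1 \<le> m" "1 \<le> n"
  shows "L2_inner I\<^sub>\<pi> (X m) (X n) = (if m = n then 1 else 0)"
proof -
  have "X m x * X n x
      = (cos (of_int (int m - int n) * x) - cos (of_int (int m + int n) * x)) * (1 / pi)" for x
  proof -
    have "X m x * X n x = (2 / pi) * (sin (real m * x) * sin (real n * x))"
      by (simp add: X_def mult_ac flip: real_sqrt_mult)
    also have "\<dots> = (2 / pi) * ((cos (real m * x - real n * x) - cos (real m * x + real n * x)) / 2)"
      by (simp only: sin_times_sin)
    finally show ?thesis by (simp add: algebra_simps)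
  qed
  then have "L2_inner I\<^sub>\<pi> (X m) (X n)
      = (\<integral>x. (cos (of_int (int m - int n) * x) - cos (of_int (int m + int n) * x)) * (1 / pi)
          \<partial>lebesgue_on I\<^sub>\<pi>)"
    by (simp only: L2_inner_def)
  also have "\<dots> = ((if int m - int n = 0 then pi else 0) - (if int m + int n = 0 then pi else 0)) * (1 / pi)"
    by (simp only: integral_mult_left_zero Bochner_Integration.integral_diff[OF cos_integral(1) cos_integral(1)] cos_integral(2))
  finally show ?thesis using assms by auto
qed

text \<open>
  Expanding the square and using orthonormality. Three facts are read off from this identity:
  Bessel's inequality, that the Fourier sum is the best approximation by sine sums of given
  length, and the values of the coefficients of a limit.
\<close>

lemma L2_norm_diff_sine_sum:
  assumes f: "f \<in> L2 I\<^sub>\<pi>"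
  shows "(L2_norm I\<^sub>\<pi> (\<lambda>x. f x - (\<Sum>n = 1..N. c n * X n x)))\<^sup>2
    = (L2_norm I\<^sub>\<pi> f)\<^sup>2 - (\<Sum>n = 1..N. (coef f n)\<^sup>2) + (\<Sum>n = 1..N. (coef f n - c n)\<^sup>2)"
proof -
  define p where "p = (\<lambda>x. \<Sum>n = 1..N. c n * X n x)"
  have p: "p \<in> L2 I\<^sub>\<pi>" unfolding p_def by (rule sine_sum_in_L2)
  have pI: "L2_inner I\<^sub>\<pi> p h = (\<Sum>n = 1..N. c n * coef h n)" if "h \<in> L2 I\<^sub>\<pi>" for h
    unfolding p_def coef_def using that
    by (subst L2_inner_sum_left) (auto simp: X_in_L2 L2_inner_commute)
  have cp: "coef p n = c n" if "n \<in> {1..N}" for n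
  proof -
    have "coef p n = (\<Sum>i = 1..N. c i * L2_inner I\<^sub>\<pi> (X i) (X n))"
      unfolding coef_def p_def by (rule L2_inner_sum_left) (auto simp: X_in_L2)
    also have "\<dots> = (\<Sum>i = 1..N. if i = n then c i else 0)"
      using that by (intro sum.cong) (auto simp: X_orthonormal)
    finally show ?thesis using that by simp
  qed
  have "(L2_norm I\<^sub>\<pi> (\<lambda>x. f x - p x))\<^sup>2 = L2_inner I\<^sub>\<pi> f f - L2_inner I\<^sub>\<pi> p f - (L2_inner I\<^sub>\<pi> p f - L2_inner I\<^sub>\<pi> p p)"
    unfolding L2_norm_sq
    using L2_inner_diff_left[OF f p L2_diff[OF f p]] L2_inner_diff_left[OF f p f] L2_inner_diff_left[OF f p p]
      L2_inner_commute[of "I\<^sub>\<pi>" f p] L2_inner_commute[of "I\<^sub>\<pi>" f "\<lambda>x. f x - p x"]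
      L2_inner_commute[of "I\<^sub>\<pi>" p "\<lambda>x. f x - p x"] by linarith
  also have "\<dots> = (L2_norm I\<^sub>\<pi> f)\<^sup>2 - (\<Sum>n = 1..N. (coef f n)\<^sup>2) + (\<Sum>n = 1..N. (coef f n - c n)\<^sup>2)"
    unfolding L2_norm_sq pI[OF f] pI[OF p]
    by (simp add: cp power2_eq_square algebra_simps sum.distrib sum_subtractf sum_distrib_left)
  finally show ?thesis by (simp add: p_def)
qed

section \<open>Completeness of the sine system\<close>

definition sine_poly :: "(real \<Rightarrow> real) \<Rightarrow> bool" where
  "sine_poly u \<longleftrightarrow> (\<exists>c N. u = (\<lambda>x. \<Sum>n = 1..N. c n * X n x))"

lemma sine_poly_in_L2: "sine_poly u \<Longrightarrow> u \<in> L2 I\<^sub>\<pi>"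
  by (auto simp: sine_poly_def sine_sum_in_L2)

lemma sine_poly_scale_X: "sine_poly (\<lambda>x. c * X n x)"
proof -
  have "c * X n x = (\<Sum>m = 1..n. (if m = n then c else 0) * X m x)" for x
    by (cases n) (auto simp: X_def if_distrib[of "\<lambda>y. y * _"] cong: if_cong)
  then have "(\<lambda>x. c * X n x) = (\<lambda>x. \<Sum>m = 1..n. (if m = n then c else 0) * X m x)" by blast
  then show ?thesis unfolding sine_poly_def by (intro exI)
qed

lemma sine_poly_add:
  assumes "sine_poly u" "sine_poly v"
  shows "sine_poly (\<lambda>x. u x + v x)"
proof -
  obtain c N d M where u: "u = (\<lambda>x. \<Sum>n = 1..N. c n * X n x)" and v: "v = (\<lambda>x. \<Sum>n = 1..M. d n * X n x)"
    using assms by (auto simp: sine_poly_def)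
  have pad: "(\<Sum>n = 1..k. b n * X n x) = (\<Sum>n = 1..max N M. (if n \<le> k then b n else 0) * X n x)"
    if "k \<le> max N M" for k b x
    using that by (intro sum.mono_neutral_cong_left) auto
  have "(\<lambda>x. u x + v x)
      = (\<lambda>x. \<Sum>n = 1..max N M. ((if n \<le> N then c n else 0) + (if n \<le> M then d n else 0)) * X n x)"
    unfolding u v by (subst (1 2) pad) (auto simp: sum.distrib distrib_right)
  then show ?thesis unfolding sine_poly_def by (intro exI)
qed

lemma sine_poly_sum: "(\<And>i. i \<in> F \<Longrightarrow> sine_poly (u i)) \<Longrightarrow> sine_poly (\<lambda>x. \<Sum>i\<in>F. u i x)"
proof (induction F rule: infinite_finite_induct)
  case (insert i F)
  then show ?case by (simp add: sine_poly_add)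
qed (use sine_poly_scale_X[of 0] in auto)

lemma sine_poly_scale:
  assumes "sine_poly u"
  shows "sine_poly (\<lambda>x. a * u x)"
proof -
  obtain c N where u: "u = (\<lambda>x. \<Sum>n = 1..N. c n * X n x)"
    using assms by (auto simp: sine_poly_def)
  have "sine_poly (\<lambda>x. \<Sum>n = 1..N. (a * c n) * X n x)"
    by (intro sine_poly_sum sine_poly_scale_X)
  then show ?thesis by (simp add: u sum_distrib_left mult.assoc)
qed

text \<open>
  Multiplication by $\cos x$ shifts frequencies:
  $\sin(nx)\cos x = \frac12(\sin((n+1)x) + \sin((n-1)x))$. For \<open>n = 1\<close> the second term vanishes.
\<close>

lemma sine_poly_mult_cos:
  assumes "sine_poly u"
  shows "sine_poly (\<lambda>x. u x * cos x)"
proof -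
  obtain c N where u: "u = (\<lambda>x. \<Sum>n = 1..N. c n * X n x)"
    using assms by (auto simp: sine_poly_def)
  have "X n x * cos x = X (n + 1) x * (1 / 2) + X (n - 1) x * (1 / 2)" if "n \<ge> 1" for n x
  proof -
    have "sin (real n * x) * cos x = (sin (real (n + 1) * x) + sin (real (n - 1) * x)) / 2"
      using that sin_times_cos[of "real n * x" x] by (simp add: algebra_simps of_nat_diff)
    then show ?thesis unfolding X_def by (simp only: mult.assoc) (simp add: algebra_simps)
  qed
  then have "u x * cos x = (\<Sum>n = 1..N. c n / 2 * X (n + 1) x + c n / 2 * X (n - 1) x)" for x
    unfolding u sum_distrib_right by (intro sum.cong) (simp_all add: mult.assoc distrib_left)
  then show ?thesis by (simp only:) (intro sine_poly_sum sine_poly_add sine_poly_scale_X)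
qed

lemma sine_poly_sin_cos_power: "sine_poly (\<lambda>x. sin x * cos x ^ j)"
proof (induction j)
  case 0
  have "(\<lambda>x. sin x) = (\<lambda>x. sqrt (pi / 2) * X 1 x)"
    by (auto simp: X_def real_sqrt_divide)
  then show ?case using sine_poly_scale_X by (simp del: One_nat_def)
next
  case (Suc j)
  have "(\<lambda>x::real. sin x * cos x ^ Suc j) = (\<lambda>x. (sin x * cos x ^ j) * cos x)"
    by (simp add: mult_ac)
  then show ?case using sine_poly_mult_cos[OF Suc] by (simp only:)
qed

definition sine_approximable :: "(real \<Rightarrow> real) \<Rightarrow> bool" where
  "sine_approximable f \<longleftrightarrow> f \<in> L2 I\<^sub>\<pi> \<and> (\<forall>e>0. \<exists>p. sine_poly p \<and> L2_norm I\<^sub>\<pi> (\<lambda>x. f x - p x) < e)"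

lemma sine_approximable_limit:
  assumes f: "f \<in> L2 I\<^sub>\<pi>" and u: "\<And>j::nat. sine_approximable (u j)"
    and lim: "(\<lambda>j. L2_norm I\<^sub>\<pi> (\<lambda>x. f x - u j x)) \<longlonglongrightarrow> 0"
  shows "sine_approximable f"
  unfolding sine_approximable_def
proof (intro conjI allI impI f)
  fix e :: real assume e: "0 < e"
  have "\<forall>\<^sub>F j in sequentially. L2_norm I\<^sub>\<pi> (\<lambda>x. f x - u j x) < e / 2"
    using lim e by (intro order_tendstoD) auto
  then obtain j where j: "L2_norm I\<^sub>\<pi> (\<lambda>x. f x - u j x) < e / 2"
    by (auto simp: eventually_sequentially)
  obtain p where p: "sine_poly p" "L2_norm I\<^sub>\<pi> (\<lambda>x. u j x - p x) < e / 2"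
    using u[of j] e unfolding sine_approximable_def by (meson half_gt_zero)
  have "L2_norm I\<^sub>\<pi> (\<lambda>x. f x - p x) < e"
    using L2_norm_triangle_between[OF f _ sine_poly_in_L2[OF p(1)], of "u j"] u[of j] j p(2)
    by (auto simp: sine_approximable_def)
  then show "\<exists>p. sine_poly p \<and> L2_norm I\<^sub>\<pi> (\<lambda>x. f x - p x) < e" using p(1) by blast
qed

text \<open>
  Since \<open>cos\<close> is injective on $[0,\pi]$, Weierstrass' theorem for \<open>h \<circ> arccos\<close> approximates \<open>h\<close>
  uniformly by polynomials in $\cos x$; the factor $\sin x$ turns these into sine sums.
\<close>

lemma sine_approximable_sin_times_continuous:
  assumes h: "continuous_on UNIV h"
  shows "sine_approximable (\<lambda>x. sin x * h x)"
proof -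
  have hm: "(\<lambda>x. sin x * h x) \<in> borel_measurable (lebesgue_on I\<^sub>\<pi>)"
    by (intro continuous_imp_measurable_on_sets_lebesgue continuous_intros continuous_on_subset[OF h]) auto
  have "bounded ((\<lambda>x. sin x * h x) ` {0..pi})"
    by (intro compact_imp_bounded compact_continuous_image continuous_intros continuous_on_subset[OF h]) auto
  then obtain b where b: "\<And>x. x \<in> {0..pi} \<Longrightarrow> \<bar>sin x * h x\<bar> \<le> b"
    unfolding bounded_iff by force
  then have L: "(\<lambda>x. sin x * h x) \<in> L2 I\<^sub>\<pi>"
    by (intro L2_bounded[OF hm, of b] b) auto
  show ?thesis
    unfolding sine_approximable_def
  proof (intro conjI allI impI L)
    fix e :: real assume e: "0 < e"
    have "continuous_on {-1..1} (h \<circ> arccos)"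
      by (intro continuous_on_compose continuous_on_arccos' continuous_on_subset[OF h]) auto
    then obtain g where g: "real_polynomial_function g"
      and gh: "\<And>y. y \<in> {-1..1} \<Longrightarrow> \<bar>(h \<circ> arccos) y - g y\<bar> < e / 3"
      using Stone_Weierstrass_real_polynomial_function[of "{-1..1}" "h \<circ> arccos" "e / 3"] e by auto
    obtain a N where g_eq: "g = (\<lambda>y. \<Sum>i\<le>N. a i * y ^ i)"
      using real_polynomial_function_imp_sum[OF g] by auto
    define p where "p = (\<lambda>x. sin x * g (cos x))"
    have "sine_poly (\<lambda>x. \<Sum>i\<le>N. a i * (sin x * cos x ^ i))"
      by (intro sine_poly_sum sine_poly_scale sine_poly_sin_cos_power)
    then have p: "sine_poly p"
      by (simp add: p_def g_eq sum_distrib_left mult.left_commute)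
    have "\<bar>sin x * h x - p x\<bar> \<le> e / 3" if x: "x \<in> I\<^sub>\<pi>" for x
    proof -
      have "\<bar>sin x * h x - p x\<bar> = \<bar>sin x\<bar> * \<bar>h x - g (cos x)\<bar>"
        by (simp add: p_def abs_mult flip: right_diff_distrib)
      also have "\<dots> \<le> 1 * (e / 3)"
        using gh[of "cos x"] x by (intro mult_mono) (auto simp: arccos_cos)
      finally show ?thesis by simp
    qed
    then have "L2_norm I\<^sub>\<pi> (\<lambda>x. sin x * h x - p x) \<le> sqrt pi * (e / 3)"
      using hm sine_poly_in_L2[OF p] e by (intro L2_norm_bounded) (auto simp: L2_def)
    (* pi < 9, so uniform distance e / 3 is enough. *)
    also have "\<dots> < 3 * (e / 3)"
      using e pi_less_4 by (intro mult_strict_right_mono) (auto intro!: real_less_lsqrt)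
    finally show "\<exists>p. sine_poly p \<and> L2_norm I\<^sub>\<pi> (\<lambda>x. sin x * h x - p x) < e"
      using p by auto
  qed
qed

text \<open>
  A Lebesgue measurable function is an almost everywhere limit of continuous functions, which may be clipped
  to the bound of \<open>h\<close>.
\<close>

lemma sine_approximable_sin_times_bounded:
  assumes h: "h \<in> borel_measurable (lebesgue_on I\<^sub>\<pi>)" and b: "\<And>x. x \<in> I\<^sub>\<pi> \<Longrightarrow> \<bar>h x\<bar> \<le> b"
  shows "sine_approximable (\<lambda>x. sin x * h x)"
proof -
  have "h measurable_on I\<^sub>\<pi>"
    using h by (simp add: measurable_on_iff_borel_measurable)
  then obtain N g where N: "negligible N" and gc: "\<And>n. continuous_on UNIV (g n)"
    and gl: "\<And>x. x \<notin> N \<Longrightarrow> (\<lambda>n. g n x) \<longlonglongrightarrow> (if x \<in> I\<^sub>\<pi> then h x else 0)"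
    unfolding measurable_on_def by blast
  define v where "v = (\<lambda>n x. max (-b) (min b (g n x)))"
  have vc: "continuous_on UNIV (v n)" for n
    unfolding v_def by (intro continuous_intros gc)
  have sm: "sin \<in> borel_measurable (lebesgue_on I\<^sub>\<pi>)"
    by (intro continuous_imp_measurable_on_sets_lebesgue continuous_intros) auto
  have b0: "0 \<le> b" using b[of 1] pi_ge_two by auto
  have vb: "\<bar>v n x\<bar> \<le> b" for n x using b0 by (auto simp: v_def)
  have shb: "\<bar>sin x * r\<bar> \<le> \<bar>r\<bar>" for x r :: real
    by (simp add: abs_mult mult_left_le_one_le)
  have shm: "(\<lambda>x. sin x * h x) \<in> borel_measurable (lebesgue_on I\<^sub>\<pi>)"
    using h sm by simp
  show ?thesis
  proof (rule sine_approximable_limit[where u="\<lambda>n x. sin x * v n x"])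
    show "(\<lambda>x. sin x * h x) \<in> L2 I\<^sub>\<pi>"
      using shb b by (intro L2_bounded[OF shm, of b]) (blast intro: order_trans)
    show "sine_approximable (\<lambda>x. sin x * v n x)" for n
      by (rule sine_approximable_sin_times_continuous[OF vc])
    show "(\<lambda>n. L2_norm I\<^sub>\<pi> (\<lambda>x. sin x * h x - sin x * v n x)) \<longlonglongrightarrow> 0"
    proof (rule L2_norm_dominated_convergence[where w="\<lambda>_. 2 * b"])
      show "(\<lambda>x. sin x * v n x) \<in> borel_measurable (lebesgue_on I\<^sub>\<pi>)" for n
        by (intro continuous_imp_measurable_on_sets_lebesgue continuous_intros continuous_on_subset[OF vc]) auto
      show "(\<lambda>_. 2 * b) \<in> L2 I\<^sub>\<pi>" by (rule L2_bounded) auto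
      show "\<bar>sin x * h x - sin x * v n x\<bar> \<le> 2 * b" if "x \<in> I\<^sub>\<pi>" for n x
        using shb[of x "h x - v n x"] b[OF that] vb[of n x] by (simp add: right_diff_distrib)
      have "AE x in lebesgue. x \<notin> N"
        using N by (auto simp: negligible_iff_null_sets intro: AE_not_in)
      then have "AE x in lebesgue_on I\<^sub>\<pi>. x \<notin> N"
        by (simp add: AE_restrict_space_iff) (auto elim: AE_mp)
      then show "AE x in lebesgue_on I\<^sub>\<pi>. (\<lambda>n. sin x * v n x) \<longlonglongrightarrow> sin x * h x"
      proof (rule AE_mp, intro AE_I2 impI)
        fix x assume x: "x \<in> space (lebesgue_on I\<^sub>\<pi>)" "x \<notin> N"
        then have "(\<lambda>n. v n x) \<longlonglongrightarrow> max (-b) (min b (h x))"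
          unfolding v_def using gl[of x] by (intro tendsto_intros) auto
        moreover have "max (-b) (min b (h x)) = h x" using b[of x] x by auto
        ultimately show "(\<lambda>n. sin x * v n x) \<longlonglongrightarrow> sin x * h x"
          by (intro tendsto_intros) simp
      qed
    qed (rule shm)
  qed
qed

text \<open>
  Dividing by $\sin x$ is harmless once \<open>f\<close> is cut off where it is large and near the end points,
  where $\sin x$ is small.
\<close>

lemma sine_approximable_L2:
  assumes f: "f \<in> L2 I\<^sub>\<pi>"
  shows "sine_approximable f"
proof -
  have fm [measurable]: "f \<in> borel_measurable (lebesgue_on I\<^sub>\<pi>)" using f by (simp add: L2_def)
  have sm [measurable]: "sin \<in> borel_measurable (lebesgue_on I\<^sub>\<pi>)"
    by (intro continuous_imp_measurable_on_sets_lebesgue continuous_intros) auto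
  define h where "h = (\<lambda>(n::nat) x. if \<bar>f x\<bar> \<le> real n \<and> 1 / real (Suc n) \<le> sin x then f x / sin x else 0)"
  have hm [measurable]: "h n \<in> borel_measurable (lebesgue_on I\<^sub>\<pi>)" for n
    unfolding h_def by measurable
  have hb: "\<bar>h n x\<bar> \<le> real n * real (Suc n)" for n x
  proof (cases "\<bar>f x\<bar> \<le> real n \<and> 1 / real (Suc n) \<le> sin x")
    case True
    moreover have "0 < 1 / real (Suc n)" by simp
    ultimately have s: "0 < sin x" by linarith
    have "\<bar>f x\<bar> / sin x \<le> real n / (1 / real (Suc n))"
      using True by (intro frac_le) auto
    then show ?thesis using True s by (simp add: h_def)
  qed (auto simp: h_def)
  have sh: "sin x * h n x = (if \<bar>f x\<bar> \<le> real n \<and> 1 / real (Suc n) \<le> sin x then f x else 0)"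
    if "x \<in> I\<^sub>\<pi>" for n x
    using that sin_gt_zero[of x] by (auto simp: h_def)
  show ?thesis
  proof (rule sine_approximable_limit[where u="\<lambda>n x. sin x * h n x", OF f])
    show "sine_approximable (\<lambda>x. sin x * h n x)" for n
      by (rule sine_approximable_sin_times_bounded[OF hm hb])
    show "(\<lambda>n. L2_norm I\<^sub>\<pi> (\<lambda>x. f x - sin x * h n x)) \<longlonglongrightarrow> 0"
    proof (rule L2_norm_dominated_convergence[where w="\<lambda>x. \<bar>f x\<bar>"])
      show "(\<lambda>x. \<bar>f x\<bar>) \<in> L2 I\<^sub>\<pi>" using f by (simp add: L2_def)
      show "\<bar>f x - sin x * h n x\<bar> \<le> \<bar>f x\<bar>" if "x \<in> I\<^sub>\<pi>" for n x
        unfolding sh[OF that] by auto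
      show "AE x in lebesgue_on I\<^sub>\<pi>. (\<lambda>n. sin x * h n x) \<longlonglongrightarrow> f x"
      proof (intro AE_I2 tendsto_eventually)
        fix x assume "x \<in> space (lebesgue_on I\<^sub>\<pi>)"
        then have x: "x \<in> I\<^sub>\<pi>" by simp
        have s: "0 < sin x" using x by (intro sin_gt_zero) auto
        have "\<forall>\<^sub>F n in sequentially. \<bar>f x\<bar> \<le> real n"
          using filterlim_real_sequentially by (auto simp: filterlim_at_top)
        moreover have "\<forall>\<^sub>F n in sequentially. 1 / real (Suc n) < sin x"
          using order_tendstoD(2)[OF LIMSEQ_inverse_real_of_nat s] by (simp add: inverse_eq_divide)
        ultimately show "\<forall>\<^sub>F n in sequentially. sin x * h n x = f x"
          by eventually_elim (simp add: sh[OF x])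
      qed
    qed measurable
  qed
qed

section \<open>Parseval and uniformly convergent sine series\<close>

lemma bessel:
  assumes "f \<in> L2 I\<^sub>\<pi>"
  shows "(\<Sum>n = 1..N. (coef f n)\<^sup>2) \<le> (L2_norm I\<^sub>\<pi> f)\<^sup>2"
proof -
  have "0 \<le> (L2_norm I\<^sub>\<pi> (\<lambda>x. f x - (\<Sum>n = 1..N. coef f n * X n x)))\<^sup>2" by simp
  then show ?thesis by (simp add: L2_norm_diff_sine_sum[OF assms] del: One_nat_def)
qed

lemma abs_coef_le_norm:
  assumes "f \<in> L2 I\<^sub>\<pi>" "1 \<le> n"
  shows "\<bar>coef f n\<bar> \<le> L2_norm I\<^sub>\<pi> f"
proof -
  have "(coef f n)\<^sup>2 \<le> (\<Sum>m = 1..n. (coef f m)\<^sup>2)"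
    using assms(2) by (intro member_le_sum) auto
  also have "\<dots> \<le> (L2_norm I\<^sub>\<pi> f)\<^sup>2" by (rule bessel[OF assms(1)])
  finally show ?thesis
    using L2_norm_nonneg abs_le_square_iff[of "coef f n" "L2_norm I\<^sub>\<pi> f"] by (simp add: abs_of_nonneg)
qed

lemma sum_Icc_eq_sum_Suc: fixes u :: "nat \<Rightarrow> real" shows "(\<Sum>n = 1..N. u n) = (\<Sum>n<N. u (Suc n))"
  by (simp add: sum.atLeast1_atMost_eq)

text \<open>
  If a sine sum of length \<open>N\<close> is close to \<open>f\<close>, then the Fourier sum of length \<open>N\<close> is at least as
  close, and the partial sums of squared coefficients increase from there on.
\<close>

theorem parseval:
  assumes f: "f \<in> L2 I\<^sub>\<pi>"
  shows "(\<lambda>n. (coef f (Suc n))\<^sup>2) sums (L2_norm I\<^sub>\<pi> f)\<^sup>2"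
  unfolding sums_def
proof (rule LIMSEQ_I)
  fix e :: real assume e: "0 < e"
  let ?S = "\<lambda>N. \<Sum>n<N. (coef f (Suc n))\<^sup>2"
  have "0 < sqrt e" using e by simp
  then obtain p where "sine_poly p" and pe: "L2_norm I\<^sub>\<pi> (\<lambda>x. f x - p x) < sqrt e"
    using sine_approximable_L2[OF f] unfolding sine_approximable_def by blast
  then obtain c N where p: "p = (\<lambda>x. \<Sum>n = 1..N. c n * X n x)"
    by (auto simp: sine_poly_def)
  have "(L2_norm I\<^sub>\<pi> (\<lambda>x. f x - p x))\<^sup>2 < (sqrt e)\<^sup>2"
    using pe by (intro power_strict_mono) (auto simp: L2_norm_nonneg)
  moreover have "0 \<le> (\<Sum>n = 1..N. (coef f n - c n)\<^sup>2)" by (intro sum_nonneg) auto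
  ultimately have N: "(L2_norm I\<^sub>\<pi> f)\<^sup>2 - ?S N < e"
    using e L2_norm_diff_sine_sum[OF f, of c N] sum_Icc_eq_sum_Suc[of "\<lambda>n. (coef f n)\<^sup>2" N]
    unfolding p by (simp del: One_nat_def)
  show "\<exists>n0. \<forall>n\<ge>n0. norm (?S n - (L2_norm I\<^sub>\<pi> f)\<^sup>2) < e"
  proof (intro exI allI impI)
    fix n assume n: "N \<le> n"
    have "?S N \<le> ?S n" using n by (intro sum_mono2) auto
    moreover have "?S n \<le> (L2_norm I\<^sub>\<pi> f)\<^sup>2"
      using bessel[OF f, of n] sum_Icc_eq_sum_Suc[of "\<lambda>n. (coef f n)\<^sup>2" n] by (simp del: One_nat_def)
    ultimately show "norm (?S n - (L2_norm I\<^sub>\<pi> f)\<^sup>2) < e" using N by simp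
  qed
qed

lemma L2_norm_le_of_coef_le:
  assumes "u \<in> L2 I\<^sub>\<pi>" "v \<in> L2 I\<^sub>\<pi>" "0 \<le> r"
    and le: "\<And>n. 1 \<le> n \<Longrightarrow> \<bar>coef u n\<bar> \<le> r * \<bar>coef v n\<bar>"
  shows "L2_norm I\<^sub>\<pi> u \<le> r * L2_norm I\<^sub>\<pi> v"
proof -
  have "(L2_norm I\<^sub>\<pi> u)\<^sup>2 \<le> r\<^sup>2 * (L2_norm I\<^sub>\<pi> v)\<^sup>2"
  proof (rule sums_le[OF _ parseval[OF assms(1)] sums_mult[OF parseval[OF assms(2)]]])
    fix n
    show "(coef u (Suc n))\<^sup>2 \<le> r\<^sup>2 * (coef v (Suc n))\<^sup>2"
      using power_mono[OF le[of "Suc n"], of 2] by (simp add: power_mult_distrib)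
  qed
  then show ?thesis
    using assms(3) L2_norm_nonneg by (intro L2_norm_le_square) (auto simp: power_mult_distrib)
qed

text \<open>
  Since $|X_n| \le 1$, absolute summability of the coefficients makes the series converge uniformly,
  and the measure of $(0,\pi)$ is finite, so the uniform limit is also the limit in $L^2$. Both
  multiplier sequences to which this is applied decay like $n^{-2}$.
\<close>

lemma sine_series_converges:
  assumes c: "summable (\<lambda>n. \<bar>c (Suc n)\<bar>)"
  shows "sine_series c \<in> L2 I\<^sub>\<pi>"
    and "(\<lambda>N. L2_norm I\<^sub>\<pi> (\<lambda>x. sine_series c x - (\<Sum>n = 1..N. c n * X n x))) \<longlonglongrightarrow> 0"
proof -
  define h where "h = (\<lambda>x. \<Sum>n. c (Suc n) * X (Suc n) x)"
  let ?p = "\<lambda>N x. \<Sum>n<N. c (Suc n) * X (Suc n) x"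
  have "uniform_limit UNIV ?p h sequentially"
    unfolding h_def using c
    by (intro Weierstrass_m_test[where M="\<lambda>n. \<bar>c (Suc n)\<bar>"])
       (auto simp: abs_mult intro: mult_right_le_one_le X_bound)
  note lim = uniform_limitD[OF this]
  have hm: "h \<in> borel_measurable (lebesgue_on I\<^sub>\<pi>)"
    unfolding h_def by measurable
  have pL: "?p N \<in> L2 I\<^sub>\<pi>" for N
    by (intro L2_sum L2_scale X_in_L2)
  have dL: "\<forall>\<^sub>F N in sequentially. (\<lambda>x. h x - ?p N x) \<in> L2 I\<^sub>\<pi> \<and>
      L2_norm I\<^sub>\<pi> (\<lambda>x. h x - ?p N x) \<le> sqrt pi * e" if e: "0 < e" for e
    using lim[OF e]
  proof eventually_elim
    case (elim N)
    have bd: "\<bar>h x - ?p N x\<bar> \<le> e" for x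
      using elim by (auto simp: dist_real_def abs_minus_commute intro: less_imp_le)
    have "(\<lambda>x. h x - ?p N x) \<in> borel_measurable (lebesgue_on I\<^sub>\<pi>)"
      using hm by measurable
    then show ?case using bd e by (auto intro: L2_bounded L2_norm_bounded)
  qed
  obtain N where "(\<lambda>x. h x - ?p N x) \<in> L2 I\<^sub>\<pi>"
    using dL[of 1] by (auto simp: eventually_sequentially)
  from L2_add[OF this pL[of N]] have hL: "h \<in> L2 I\<^sub>\<pi>" by simp
  have "(\<lambda>N. L2_norm I\<^sub>\<pi> (\<lambda>x. h x - ?p N x)) \<longlonglongrightarrow> 0"
  proof (rule order_tendstoI)
    fix e :: real assume e: "0 < e"
    have "0 < e / (2 * sqrt pi)" using e by simp
    from dL[OF this] show "\<forall>\<^sub>F N in sequentially. L2_norm I\<^sub>\<pi> (\<lambda>x. h x - ?p N x) < e"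
    proof eventually_elim
      case (elim N)
      have "sqrt pi * (e / (2 * sqrt pi)) < e" using e by simp
      then show ?case using elim by linarith
    qed
  qed (auto intro!: always_eventually less_le_trans[OF _ L2_norm_nonneg])
  then have "(\<lambda>N. L2_norm I\<^sub>\<pi> (\<lambda>x. h x - (\<Sum>n = 1..N. c n * X n x))) \<longlonglongrightarrow> 0"
    by (simp only: sum_Icc_eq_sum_Suc)
  with hL have "\<exists>h. h \<in> L2 I\<^sub>\<pi> \<and> (\<lambda>N. L2_norm I\<^sub>\<pi> (\<lambda>x. h x - (\<Sum>n = 1..N. c n * X n x))) \<longlonglongrightarrow> 0"
    by blast
  from someI_ex[OF this]
  show "sine_series c \<in> L2 I\<^sub>\<pi>"
    and "(\<lambda>N. L2_norm I\<^sub>\<pi> (\<lambda>x. sine_series c x - (\<Sum>n = 1..N. c n * X n x))) \<longlonglongrightarrow> 0"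
    unfolding sine_series_def by auto
qed

lemma coef_sine_series:
  assumes c: "summable (\<lambda>n. \<bar>c (Suc n)\<bar>)" and n: "1 \<le> n"
  shows "coef (sine_series c) n = c n"
proof -
  let ?h = "sine_series c" and ?d = "\<lambda>N. L2_norm I\<^sub>\<pi> (\<lambda>x. sine_series c x - (\<Sum>n = 1..N. c n * X n x))"
  have "(\<lambda>N. (?d N)\<^sup>2) \<longlonglongrightarrow> 0\<^sup>2"
    by (intro tendsto_power sine_series_converges[OF c])
  moreover have "(coef ?h n - c n)\<^sup>2 \<le> (?d N)\<^sup>2" if "n \<le> N" for N
  proof -
    have "(coef ?h n - c n)\<^sup>2 \<le> (\<Sum>m = 1..N. (coef ?h m - c m)\<^sup>2)"
      using that n by (intro member_le_sum[where f="\<lambda>m. (coef ?h m - c m)\<^sup>2"]) auto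
    also have "\<dots> \<le> (?d N)\<^sup>2"
      using bessel[OF sine_series_converges(1)[OF c], of N]
      by (simp add: L2_norm_diff_sine_sum[OF sine_series_converges(1)[OF c]] del: One_nat_def)
    finally show ?thesis .
  qed
  ultimately have "(coef ?h n - c n)\<^sup>2 \<le> 0\<^sup>2"
    by (intro LIMSEQ_le_const[of "\<lambda>N. (?d N)\<^sup>2"]) auto
  then show ?thesis by simp
qed

lemma coef_diff:
  "u \<in> L2 I\<^sub>\<pi> \<Longrightarrow> v \<in> L2 I\<^sub>\<pi> \<Longrightarrow> coef (\<lambda>x. u x - v x) n = coef u n - coef v n"
  by (simp add: coef_def L2_inner_diff_left X_in_L2)

lemma summable_inverse_square_times_coef:
  assumes v: "v \<in> L2 I\<^sub>\<pi>" and bd: "\<forall>n\<ge>1. \<bar>m n\<bar> \<le> L / (real n)\<^sup>2"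
  shows "summable (\<lambda>n. \<bar>m (Suc n) * coef v (Suc n)\<bar>)"
proof (rule summable_comparison_test')
  show "summable (\<lambda>n. L * L2_norm I\<^sub>\<pi> v * inverse ((real (Suc n))\<^sup>2))"
    using inverse_power_summable[of 2, where 'a=real]
    by (intro summable_mult) (subst summable_Suc_iff, auto)
  fix n :: nat
  have "\<bar>m (Suc n)\<bar> * \<bar>coef v (Suc n)\<bar> \<le> L / (real (Suc n))\<^sup>2 * L2_norm I\<^sub>\<pi> v"
    using abs_coef_le_norm[OF v, of "Suc n"] by (intro mult_mono' bd[rule_format]) auto
  then show "norm \<bar>m (Suc n) * coef v (Suc n)\<bar> \<le> L * L2_norm I\<^sub>\<pi> v * inverse ((real (Suc n))\<^sup>2)"
    by (simp add: abs_mult divide_inverse mult_ac del: of_nat_Suc)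
qed

section \<open>Sobolev bounds and interpolation\<close>

lemma Hs_norm_sums:
  assumes "in_Hs s f"
  shows "(\<lambda>n. (1 + (real (Suc n))\<^sup>2) powr s * (coef f (Suc n))\<^sup>2) sums (Hs_norm s f)\<^sup>2"
proof -
  let ?w = "\<lambda>n. (1 + (real n)\<^sup>2) powr s * (coef f n)\<^sup>2"
  have "(?w has_sum infsum ?w {1..}) {1..}"
    using assms by (simp add: in_Hs_def)
  moreover have "{1..} = range Suc"
    by (auto simp: image_iff Suc_le_eq gr0_conv_Suc)
  ultimately have "(?w \<circ> Suc has_sum infsum ?w {1..}) UNIV"
    by (simp add: has_sum_reindex)
  moreover have "0 \<le> infsum ?w {1..}"
    by (intro infsum_nonneg) auto
  ultimately show ?thesis
    by (auto dest!: has_sum_imp_sums simp: Hs_norm_def o_def)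
qed

lemma L2_norm_le_Hs_norm:
  assumes f: "in_Hs s f" and s: "0 \<le> s"
  shows "L2_norm I\<^sub>\<pi> f \<le> Hs_norm s f"
proof -
  have fL: "f \<in> L2 I\<^sub>\<pi>" using f by (simp add: in_Hs_def)
  have "(L2_norm I\<^sub>\<pi> f)\<^sup>2 \<le> (Hs_norm s f)\<^sup>2"
  proof (rule sums_le[OF _ parseval[OF fL] Hs_norm_sums[OF f]])
    fix n
    have "1 \<le> (1 + (real (Suc n))\<^sup>2) powr s" using s by (intro ge_one_powr_ge_zero) auto
    then show "(coef f (Suc n))\<^sup>2 \<le> (1 + (real (Suc n))\<^sup>2) powr s * (coef f (Suc n))\<^sup>2"
      by (simp add: mult_le_cancel_right1)
  qed
  moreover have "0 \<le> Hs_norm s f"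
    unfolding Hs_norm_def by (intro real_sqrt_ge_zero infsum_nonneg) auto
  ultimately show ?thesis by (intro L2_norm_le_square)
qed

text \<open>
  Split the frequencies at $\lambda(1+n^2) = 1$: above, the Sobolev weight controls \<open>f\<close>; below,
  dividing the data \<open>g\<close> by the multiplier costs at most $1/(b\lambda)$.
\<close>

lemma L2_norm_interpolation:
  assumes f: "in_Hs (2 * k) f" and k: "0 < k" and g: "g \<in> L2 I\<^sub>\<pi>" and b: "0 < b" and l: "0 < l"
    and le: "\<And>n. 1 \<le> n \<Longrightarrow> b * \<bar>coef f n\<bar> \<le> (1 + (real n)\<^sup>2) * \<bar>coef g n\<bar>"
  shows "(L2_norm I\<^sub>\<pi> f)\<^sup>2 \<le> l powr (2 * k) * (Hs_norm (2 * k) f)\<^sup>2 + (L2_norm I\<^sub>\<pi> g)\<^sup>2 / (b * l)\<^sup>2"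
proof -
  have fL: "f \<in> L2 I\<^sub>\<pi>" using f by (simp add: in_Hs_def)
  show ?thesis
  proof (rule sums_le[OF _ parseval[OF fL] sums_add[OF sums_mult[OF Hs_norm_sums[OF f]] sums_divide[OF parseval[OF g]]]])
    fix n
    let ?w = "1 + (real (Suc n))\<^sup>2" and ?f = "coef f (Suc n)" and ?g = "coef g (Suc n)"
    have w: "0 < ?w" by (simp add: add_pos_nonneg)
    show "?f\<^sup>2 \<le> l powr (2 * k) * (?w powr (2 * k) * ?f\<^sup>2) + ?g\<^sup>2 / (b * l)\<^sup>2"
    proof (cases "1 \<le> l * ?w")
      case True
      have "1 \<le> (l * ?w) powr (2 * k)" using True k by (intro ge_one_powr_ge_zero) auto
      then have "1 * ?f\<^sup>2 \<le> (l * ?w) powr (2 * k) * ?f\<^sup>2" by (intro mult_right_mono) auto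
      also have "(l * ?w) powr (2 * k) = l powr (2 * k) * ?w powr (2 * k)"
        by (rule powr_mult)
      finally show ?thesis by (simp add: mult.assoc add_increasing2)
    next
      case False
      have "(b * l) * \<bar>?f\<bar> = l * (b * \<bar>?f\<bar>)" by simp
      also have "\<dots> \<le> l * (?w * \<bar>?g\<bar>)" using l le[of "Suc n"] by (intro mult_left_mono) auto
      also have "\<dots> = (l * ?w) * \<bar>?g\<bar>" by simp
      also have "\<dots> \<le> 1 * \<bar>?g\<bar>" using False by (intro mult_right_mono) auto
      finally have "((b * l) * \<bar>?f\<bar>)\<^sup>2 \<le> \<bar>?g\<bar>\<^sup>2"
        using b l by (intro power_mono) auto
      then have "?f\<^sup>2 \<le> ?g\<^sup>2 / (b * l)\<^sup>2"
        using b l by (simp add: power_mult_distrib field_simps)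
      then show ?thesis by (simp add: add_increasing)
    qed
  qed
qed

section \<open>Decay of the multipliers\<close>

lemma has_integral_exp_linear:
  fixes m T :: real
  assumes "m > 0" "T > 0"
  shows "((\<lambda>t. exp (- m * (T - t))) has_integral (1 - exp (- m * T)) / m) {0..T}"
proof -
  have "((\<lambda>t. exp (- m * (T - t))) has_integral exp (- m * (T - T)) / m - exp (- m * (T - 0)) / m) {0..T}"
    using assms
    by (intro fundamental_theorem_of_calculus)
       (auto intro!: derivative_eq_intros simp flip: has_real_derivative_iff_has_vector_derivative)
  then show ?thesis by (simp add: diff_divide_distrib)
qed

lemma B_bounds:
  assumes a: "continuous_on {0..T} a" and D: "\<forall>t\<in>{0..T}. D1 \<le> a t \<and> a t \<le> D2"
    and t: "t \<in> {0..T}"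
  shows "- D2 * (T - t) \<le> B T a t" "B T a t \<le> - D1 * (T - t)"
proof -
  have i: "a integrable_on {0..T}" using a by (rule integrable_continuous_real)
  have "integral {0..t} a + integral {t..T} a = integral {0..T} a"
    using t i by (intro Henstock_Kurzweil_Integration.integral_combine) auto
  then have B: "B T a t = - integral {t..T} a" by (simp add: B_def A_def)
  have it: "a integrable_on {t..T}"
    using t by (intro integrable_continuous_real continuous_on_subset[OF a]) auto
  have "integral {t..T} a \<le> integral {t..T} (\<lambda>_. D2)"
    using t D by (intro integral_le it) auto
  then show "- D2 * (T - t) \<le> B T a t" using t by (simp add: B algebra_simps)
  have "integral {t..T} (\<lambda>_. D1) \<le> integral {t..T} a"
    using t D by (intro integral_le it) auto
  then show "B T a t \<le> - D1 * (T - t)" using t by (simp add: B algebra_simps)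
qed

text \<open>
  $-D_2(T-t) \le B(t) \le -D_1(T-t)$ compares the kernel with exponentials that can be integrated,
  so \<open>\<Phi>(n, h)\<close> decays exactly like $n^{-2}$.
\<close>

lemma Phi_bounds:
  assumes T: "0 < T" and a: "continuous_on {0..T} a" and h: "continuous_on {0..T} h"
    and D: "\<forall>t\<in>{0..T}. D1 \<le> a t \<and> a t \<le> D2" and D1: "0 < D1"
    and H: "\<forall>t\<in>{0..T}. H1 \<le> h t \<and> h t \<le> H2" and H1: "0 < H1"
    and n: "1 \<le> n"
  shows "H1 * (1 - exp (- D2 * T)) / D2 / (real n)\<^sup>2 \<le> Phi T a n h"
    and "Phi T a n h \<le> H2 / D1 / (real n)\<^sup>2"
proof -
  have D2: "0 < D2" using bspec[OF D, of 0] D1 T by auto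
  have H2: "0 < H2" using bspec[OF H, of 0] H1 T by auto
  have n2: "1 \<le> (real n)\<^sup>2" using n by (simp add: one_le_power)
  have "continuous_on {0..T} (B T a)"
    unfolding B_def [abs_def] A_def [abs_def] using integrable_continuous_real[OF a]
    by (intro continuous_intros indefinite_integral_continuous_1)
  then have i: "(\<lambda>t. exp ((real n)\<^sup>2 * B T a t) * h t) integrable_on {0..T}"
    by (intro integrable_continuous_real continuous_intros h)
  have e: "exp (- ((real n)\<^sup>2 * D2) * (T - t)) \<le> exp ((real n)\<^sup>2 * B T a t)"
    "exp ((real n)\<^sup>2 * B T a t) \<le> exp (- ((real n)\<^sup>2 * D1) * (T - t))" if "t \<in> {0..T}" for t
    using mult_left_mono[OF B_bounds(1)[OF a D that], of "(real n)\<^sup>2"]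
      mult_left_mono[OF B_bounds(2)[OF a D that], of "(real n)\<^sup>2"] by (simp_all add: mult.assoc)
  have E: "((\<lambda>t. exp (- ((real n)\<^sup>2 * d) * (T - t)) * H)
      has_integral (1 - exp (- ((real n)\<^sup>2 * d) * T)) / ((real n)\<^sup>2 * d) * H) {0..T}"
    if "0 < d" for d H
    using that n T by (intro has_integral_mult_left has_integral_exp_linear mult_pos_pos) auto
  have "(1 - exp (- ((real n)\<^sup>2 * D1) * T)) / ((real n)\<^sup>2 * D1) * H2 \<le> 1 / ((real n)\<^sup>2 * D1) * H2"
    using D1 H2 n2 by (intro mult_right_mono divide_right_mono) auto
  moreover have "Phi T a n h \<le> (1 - exp (- ((real n)\<^sup>2 * D1) * T)) / ((real n)\<^sup>2 * D1) * H2"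
    unfolding Phi_def
    by (rule has_integral_le[OF integrable_integral[OF i] E[OF D1]])
       (use e H H1 in \<open>auto intro!: mult_mono intro: order_trans[OF less_imp_le]\<close>)
  ultimately show "Phi T a n h \<le> H2 / D1 / (real n)\<^sup>2"
    by (simp add: field_simps)
  have "exp (- ((real n)\<^sup>2 * D2) * T) \<le> exp (- D2 * T)"
    using n2 D2 T mult_right_mono[OF n2, of "D2 * T"] by (simp add: mult.assoc)
  then have "(1 - exp (- D2 * T)) / ((real n)\<^sup>2 * D2) * H1
      \<le> (1 - exp (- ((real n)\<^sup>2 * D2) * T)) / ((real n)\<^sup>2 * D2) * H1"
    using D2 H1 n2 by (intro mult_right_mono divide_right_mono) auto
  also have "\<dots> \<le> Phi T a n h"
    unfolding Phi_def
    by (rule has_integral_le[OF E[OF D2] integrable_integral[OF i]])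
       (use e H H1 in \<open>auto intro!: mult_mono intro: less_imp_le\<close>)
  finally show "H1 * (1 - exp (- D2 * T)) / D2 / (real n)\<^sup>2 \<le> Phi T a n h"
    by (simp add: field_simps)
qed

section \<open>The regularized solution in terms of coefficients\<close>

lemma K_L2_and_coef:
  assumes bd: "\<forall>n\<ge>1. \<bar>Phi T a n \<phi>\<^sub>\<epsilon>\<bar> \<le> L / (real n)\<^sup>2" and v: "v \<in> L2 I\<^sub>\<pi>"
  shows "K T a \<phi>\<^sub>\<epsilon> v \<in> L2 I\<^sub>\<pi>"
    and "1 \<le> n \<Longrightarrow> coef (K T a \<phi>\<^sub>\<epsilon> v) n = Phi T a n \<phi>\<^sub>\<epsilon> * coef v n"
  using sine_series_converges(1) coef_sine_series summable_inverse_square_times_coef[OF v bd]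
  by (simp_all add: K_def)

lemma tikhonov_L2_and_coef:
  assumes bd: "\<forall>n\<ge>1. \<bar>Phi T a n \<phi>\<^sub>\<epsilon>\<bar> \<le> L / (real n)\<^sup>2" and v: "v \<in> L2 I\<^sub>\<pi>" and mu: "0 < \<mu>"
  shows "tikhonov T a \<phi>\<^sub>\<epsilon> v \<mu> \<in> L2 I\<^sub>\<pi>"
    and "1 \<le> n \<Longrightarrow> coef (tikhonov T a \<phi>\<^sub>\<epsilon> v \<mu>) n
        = Phi T a n \<phi>\<^sub>\<epsilon> / (\<mu>\<^sup>2 + (Phi T a n \<phi>\<^sub>\<epsilon>)\<^sup>2) * coef v n"
proof -
  have "\<forall>n\<ge>1. \<bar>Phi T a n \<phi>\<^sub>\<epsilon> / (\<mu>\<^sup>2 + (Phi T a n \<phi>\<^sub>\<epsilon>)\<^sup>2)\<bar> \<le> (L / \<mu>\<^sup>2) / (real n)\<^sup>2"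
  proof (intro allI impI)
    fix n :: nat assume n: "1 \<le> n"
    have "\<bar>Phi T a n \<phi>\<^sub>\<epsilon>\<bar> / \<bar>\<mu>\<^sup>2 + (Phi T a n \<phi>\<^sub>\<epsilon>)\<^sup>2\<bar> \<le> (L / (real n)\<^sup>2) / \<mu>\<^sup>2"
      using mu order_trans[OF abs_ge_zero bd[rule_format, OF n]] n by (intro frac_le bd[rule_format]) auto
    then show "\<bar>Phi T a n \<phi>\<^sub>\<epsilon> / (\<mu>\<^sup>2 + (Phi T a n \<phi>\<^sub>\<epsilon>)\<^sup>2)\<bar> \<le> (L / \<mu>\<^sup>2) / (real n)\<^sup>2" by (simp add: abs_divide mult.commute)
  qed
  note s = summable_inverse_square_times_coef[OF v this]
  show "tikhonov T a \<phi>\<^sub>\<epsilon> v \<mu> \<in> L2 I\<^sub>\<pi>"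
    using sine_series_converges(1)[OF s] by (simp add: tikhonov_def)
  show "1 \<le> n \<Longrightarrow> coef (tikhonov T a \<phi>\<^sub>\<epsilon> v \<mu>) n
      = Phi T a n \<phi>\<^sub>\<epsilon> / (\<mu>\<^sup>2 + (Phi T a n \<phi>\<^sub>\<epsilon>)\<^sup>2) * coef v n"
    using coef_sine_series[OF s] by (simp add: tikhonov_def)
qed

text \<open>
  By the inequality of arithmetic and geometric means the Tikhonov multiplier is at most
  $1/(2\mu)$.
\<close>

lemma tikhonov_norm_le:
  assumes bd: "\<forall>n\<ge>1. \<bar>Phi T a n \<phi>\<^sub>\<epsilon>\<bar> \<le> L / (real n)\<^sup>2" and v: "v \<in> L2 I\<^sub>\<pi>" and mu: "0 < \<mu>"
  shows "L2_norm I\<^sub>\<pi> (tikhonov T a \<phi>\<^sub>\<epsilon> v \<mu>) \<le> 1 / (2 * \<mu>) * L2_norm I\<^sub>\<pi> v"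
proof (rule L2_norm_le_of_coef_le[OF tikhonov_L2_and_coef(1)[OF bd v mu] v])
  fix n :: nat assume n: "1 \<le> n"
  let ?p = "Phi T a n \<phi>\<^sub>\<epsilon>"
  have pos: "0 < \<mu>\<^sup>2 + ?p\<^sup>2" using mu by (simp add: add_pos_nonneg)
  have "2 * \<mu> * \<bar>?p\<bar> \<le> \<mu>\<^sup>2 + ?p\<^sup>2"
    using sum_squares_bound[of \<mu> "\<bar>?p\<bar>"] by simp
  then have "\<bar>?p / (\<mu>\<^sup>2 + ?p\<^sup>2)\<bar> \<le> 1 / (2 * \<mu>)"
    using mu pos by (simp add: abs_divide field_simps)
  then show "\<bar>coef (tikhonov T a \<phi>\<^sub>\<epsilon> v \<mu>) n\<bar> \<le> 1 / (2 * \<mu>) * \<bar>coef v n\<bar>"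
    unfolding tikhonov_L2_and_coef(2)[OF bd v mu n] abs_mult by (rule mult_right_mono) simp
qed (use mu in auto)

text \<open>
  The residual multiplier $\mu^2/(\mu^2+\Phi^2)$ stays away from zero for fixed \<open>\<mu>\<close>, so a small
  residual forces small data.
\<close>

lemma data_norm_le_residual:
  assumes bd: "\<forall>n\<ge>1. \<bar>Phi T a n \<phi>\<^sub>\<epsilon>\<bar> \<le> L / (real n)\<^sup>2" and v: "v \<in> L2 I\<^sub>\<pi>" and mu: "0 < \<mu>"
  shows "L2_norm I\<^sub>\<pi> v \<le>
    (1 + (L / \<mu>)\<^sup>2) * L2_norm I\<^sub>\<pi> (\<lambda>x. K T a \<phi>\<^sub>\<epsilon> (tikhonov T a \<phi>\<^sub>\<epsilon> v \<mu>) x - v x)"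
proof (rule L2_norm_le_of_coef_le[OF v])
  let ?h = "tikhonov T a \<phi>\<^sub>\<epsilon> v \<mu>"
  note h = tikhonov_L2_and_coef[OF bd v mu]
  note Kh = K_L2_and_coef[OF bd h(1)]
  show "(\<lambda>x. K T a \<phi>\<^sub>\<epsilon> ?h x - v x) \<in> L2 I\<^sub>\<pi>"
    by (rule L2_diff[OF Kh(1) v])
  fix n :: nat assume n: "1 \<le> n"
  let ?p = "Phi T a n \<phi>\<^sub>\<epsilon>"
  have pos: "0 < \<mu>\<^sup>2 + ?p\<^sup>2" using mu by (simp add: add_pos_nonneg)
  have "coef (\<lambda>x. K T a \<phi>\<^sub>\<epsilon> ?h x - v x) n = - (\<mu>\<^sup>2 / (\<mu>\<^sup>2 + ?p\<^sup>2)) * coef v n"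
  proof -
    have "?p\<^sup>2 / (\<mu>\<^sup>2 + ?p\<^sup>2) = 1 - \<mu>\<^sup>2 / (\<mu>\<^sup>2 + ?p\<^sup>2)"
      using pos add_divide_distrib[of "\<mu>\<^sup>2" "?p\<^sup>2" "\<mu>\<^sup>2 + ?p\<^sup>2"]
        divide_self[of "\<mu>\<^sup>2 + ?p\<^sup>2"] by linarith
    moreover have "coef (\<lambda>x. K T a \<phi>\<^sub>\<epsilon> ?h x - v x) n = ?p\<^sup>2 / (\<mu>\<^sup>2 + ?p\<^sup>2) * coef v n - coef v n"
      by (simp add: coef_diff[OF Kh(1) v] Kh(2)[OF n] h(2)[OF n] power2_eq_square)
    ultimately show ?thesis by (simp add: left_diff_distrib)
  qed
  then have res: "\<bar>coef (\<lambda>x. K T a \<phi>\<^sub>\<epsilon> ?h x - v x) n\<bar> = \<mu>\<^sup>2 / (\<mu>\<^sup>2 + ?p\<^sup>2) * \<bar>coef v n\<bar>"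
    using pos by (simp add: abs_mult abs_divide)
  have L: "0 \<le> L" using order_trans[OF abs_ge_zero bd[rule_format, of 1]] by simp
  have "L / (real n)\<^sup>2 \<le> L / 1"
    using n L by (intro divide_left_mono) (auto simp: one_le_power)
  then have "\<bar>?p\<bar> \<le> L" using bd[rule_format, OF n] by simp
  then have "?p\<^sup>2 \<le> L\<^sup>2" using abs_le_square_iff[of ?p L] L by simp
  then have "\<mu>\<^sup>2 + ?p\<^sup>2 \<le> (1 + (L / \<mu>)\<^sup>2) * \<mu>\<^sup>2"
    using mu by (simp add: distrib_right power_divide)
  then have "1 \<le> (1 + (L / \<mu>)\<^sup>2) * (\<mu>\<^sup>2 / (\<mu>\<^sup>2 + ?p\<^sup>2))"
    using pos by (simp add: field_simps)
  from mult_right_mono[OF this, of "\<bar>coef v n\<bar>"]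
  show "\<bar>coef v n\<bar> \<le> (1 + (L / \<mu>)\<^sup>2) * \<bar>coef (\<lambda>x. K T a \<phi>\<^sub>\<epsilon> ?h x - v x) n\<bar>"
    unfolding res by (simp add: mult.assoc)
qed auto

section \<open>The error estimate\<close>

lemma powr_le_powr_mult_bound:
  fixes \<epsilon> E r s :: real
  assumes "0 < \<epsilon>" "\<epsilon> \<le> E" "r \<le> s"
  shows "\<epsilon> powr s \<le> \<epsilon> powr r * E powr (s - r)"
proof -
  have "\<epsilon> powr s = \<epsilon> powr r * \<epsilon> powr (s - r)" by (simp flip: powr_add)
  also have "\<dots> \<le> \<epsilon> powr r * E powr (s - r)"
    using assms by (intro mult_left_mono powr_mono2) auto
  finally show ?thesis .
qed

text \<open>
  The choice $\lambda = \epsilon^{1/(k+1)}$ balances the two terms of the interpolation inequality: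
  both $\lambda^{2k}$ and $\epsilon^2/\lambda^2$ become $\epsilon^{2k/(k+1)}$.
\<close>

lemma source_norm_le:
  assumes eps: "0 < \<epsilon>" and k: "0 < k" and b: "0 < b" and f: "in_Hs (2 * k) f" "Hs_norm (2 * k) f \<le> M"
    and g: "g \<in> L2 I\<^sub>\<pi>" "L2_norm I\<^sub>\<pi> g \<le> G * \<epsilon>"
    and le: "\<And>n. 1 \<le> n \<Longrightarrow> b * \<bar>coef f n\<bar> \<le> (1 + (real n)\<^sup>2) * \<bar>coef g n\<bar>"
  shows "L2_norm I\<^sub>\<pi> f \<le> \<epsilon> powr (k / (k + 1)) * sqrt (M\<^sup>2 + (G / b)\<^sup>2)"
proof -
  define l where "l = \<epsilon> powr (1 / (k + 1))"
  have l: "0 < l" using eps by (simp add: l_def)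
  have lk: "l powr (2 * k) = (\<epsilon> powr (k / (k + 1)))\<^sup>2"
    using eps by (simp add: l_def powr_powr power2_eq_square flip: powr_add)
  have "\<epsilon> / l = \<epsilon> powr (k / (k + 1))"
  proof -
    have "\<epsilon> / l = \<epsilon> powr (1 - 1 / (k + 1))" using eps by (simp add: l_def powr_diff)
    also have "1 - 1 / (k + 1) = k / (k + 1)" using k by (simp add: field_simps)
    finally show ?thesis .
  qed
  moreover have "(G * \<epsilon>)\<^sup>2 / (b * l)\<^sup>2 = (\<epsilon> / l)\<^sup>2 * (G / b)\<^sup>2"
    by (simp add: power_mult_distrib power_divide mult.commute)
  ultimately have q: "(G * \<epsilon>)\<^sup>2 / (b * l)\<^sup>2 = (\<epsilon> powr (k / (k + 1)))\<^sup>2 * (G / b)\<^sup>2"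
    by simp
  have "0 \<le> Hs_norm (2 * k) f" using L2_norm_le_Hs_norm[OF f(1)] L2_norm_nonneg[of I\<^sub>\<pi> f] k by simp
  then have "(L2_norm I\<^sub>\<pi> f)\<^sup>2 \<le> l powr (2 * k) * M\<^sup>2 + (G * \<epsilon>)\<^sup>2 / (b * l)\<^sup>2"
    using f(2) g(2) L2_norm_nonneg
    by (intro order_trans[OF L2_norm_interpolation[OF f(1) k g(1) b l le]] add_mono mult_left_mono
        divide_right_mono power_mono) auto
  also have "\<dots> = (\<epsilon> powr (k / (k + 1)) * sqrt (M\<^sup>2 + (G / b)\<^sup>2))\<^sup>2"
    unfolding lk q by (simp add: power_mult_distrib distrib_left)
  finally show ?thesis by (intro L2_norm_le_square) auto
qed

text \<open>
  The bound \<open>E\<close> on the noise level turns the estimate of order $\epsilon$ for the regularized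
  solution into one of order $\epsilon^{k/(k+1)}$, the order obtained for the source.
\<close>

lemma tikhonov_discrepancy_error:
  fixes T \<mu> k \<tau> B1 B2 C1 C2 D1 D2 M \<epsilon> :: real and f g g\<^sub>\<epsilon> :: "real \<Rightarrow> real"
  defines "R \<equiv> 1 + (C2 / D1 / \<mu>)\<^sup>2"
  defines "b \<equiv> B1 * (1 - exp (- D2 * T)) / D2"
  defines "E \<equiv> B2 / D1 * M / (\<tau> - 1)"
  defines "P \<equiv> sqrt (M\<^sup>2 + ((R * \<tau> + 1) / b)\<^sup>2) + 1 / (2 * \<mu>) * (R * \<tau>) * E powr (1 - k / (k + 1))"
  assumes pos: "T > 0" "\<mu> > 0" "k > 0" "\<tau> > 1" "B1 > 0" "B2 > 0" "C1 > 0" "C2 > 0" "D1 > 0" "D2 > 0"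
    and cont: "continuous_on {0..T} a" "continuous_on {0..T} \<phi>" "continuous_on {0..T} \<phi>\<^sub>\<epsilon>"
    and \<phi>: "\<forall>t\<in>{0..T}. B1 \<le> \<phi> t \<and> \<phi> t \<le> B2"
    and \<phi>\<^sub>\<epsilon>: "\<forall>t\<in>{0..T}. C1 \<le> \<phi>\<^sub>\<epsilon> t \<and> \<phi>\<^sub>\<epsilon> t \<le> C2"
    and a: "\<forall>t\<in>{0..T}. D1 \<le> a t \<and> a t \<le> D2"
    and src: "source_of T a \<phi> f g" and g\<^sub>\<epsilon>: "g\<^sub>\<epsilon> \<in> L2 I\<^sub>\<pi>" and eps: "\<epsilon> > 0"
    and f: "in_Hs (2 * k) f" "Hs_norm (2 * k) f \<le> M"
    and noise: "L2_norm I\<^sub>\<pi> (\<lambda>x. g\<^sub>\<epsilon> x - g x) \<le> \<epsilon>"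
    and large: "\<tau> * \<epsilon> < L2_norm I\<^sub>\<pi> g\<^sub>\<epsilon>"
    and disc: "L2_norm I\<^sub>\<pi> (\<lambda>x. K T a \<phi>\<^sub>\<epsilon> (tikhonov T a \<phi>\<^sub>\<epsilon> g\<^sub>\<epsilon> \<mu>) x - g\<^sub>\<epsilon> x) = \<tau> * \<epsilon>"
  shows "\<epsilon> \<le> E"
    and "L2_norm I\<^sub>\<pi> (\<lambda>x. f x - tikhonov T a \<phi>\<^sub>\<epsilon> g\<^sub>\<epsilon> \<mu> x) \<le> \<epsilon> powr (k / (k + 1)) * P"
proof -
  let ?h = "tikhonov T a \<phi>\<^sub>\<epsilon> g\<^sub>\<epsilon> \<mu>"
  have fL: "f \<in> L2 I\<^sub>\<pi>" and gL: "g \<in> L2 I\<^sub>\<pi>"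
    and gf: "\<And>n. 1 \<le> n \<Longrightarrow> coef g n = Phi T a n \<phi> * coef f n"
    using src by (auto simp: source_of_def)
  have b: "0 < b" using pos by (simp add: b_def)
  note Phi\<phi> = Phi_bounds[OF pos(1) cont(1,2) a pos(9) \<phi> pos(5)]
  note Phi\<phi>\<^sub>\<epsilon> = Phi_bounds[OF pos(1) cont(1,3) a pos(9) \<phi>\<^sub>\<epsilon> pos(7)]
  have bd: "\<forall>n\<ge>1. \<bar>Phi T a n \<phi>\<^sub>\<epsilon>\<bar> \<le> C2 / D1 / (real n)\<^sup>2"
  proof (intro allI impI)
    fix n :: nat assume n: "1 \<le> n"
    have "0 \<le> C1 * (1 - exp (- D2 * T)) / D2 / (real n)\<^sup>2" using pos by simp
    then show "\<bar>Phi T a n \<phi>\<^sub>\<epsilon>\<bar> \<le> C2 / D1 / (real n)\<^sup>2"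
      using Phi\<phi>\<^sub>\<epsilon>[OF n] by linarith
  qed
  have g\<^sub>\<epsilon>_le: "L2_norm I\<^sub>\<pi> g\<^sub>\<epsilon> \<le> R * \<tau> * \<epsilon>"
    using data_norm_le_residual[OF bd g\<^sub>\<epsilon> pos(2)] by (simp add: disc R_def mult.assoc)
  have "L2_norm I\<^sub>\<pi> g \<le> L2_norm I\<^sub>\<pi> g\<^sub>\<epsilon> + L2_norm I\<^sub>\<pi> (\<lambda>x. g\<^sub>\<epsilon> x - g x)"
    using L2_norm_triangle_diff[OF g\<^sub>\<epsilon> L2_diff[OF g\<^sub>\<epsilon> gL]] by simp
  then have g_le: "L2_norm I\<^sub>\<pi> g \<le> (R * \<tau> + 1) * \<epsilon>"
    using g\<^sub>\<epsilon>_le noise by (simp add: distrib_right)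
  have "b * \<bar>coef f n\<bar> \<le> (1 + (real n)\<^sup>2) * \<bar>coef g n\<bar>" if n: "1 \<le> n" for n
  proof -
    have "b / (real n)\<^sup>2 \<le> \<bar>Phi T a n \<phi>\<bar>"
      using Phi\<phi>(1)[OF n] by (simp add: b_def)
    then have "b \<le> \<bar>Phi T a n \<phi>\<bar> * (real n)\<^sup>2"
      using n by (simp add: field_simps)
    also have "\<dots> \<le> \<bar>Phi T a n \<phi>\<bar> * (1 + (real n)\<^sup>2)"
      by (intro mult_left_mono) auto
    finally have "b * \<bar>coef f n\<bar> \<le> \<bar>Phi T a n \<phi>\<bar> * (1 + (real n)\<^sup>2) * \<bar>coef f n\<bar>"
      by (intro mult_right_mono) auto
    then show ?thesis by (simp add: gf[OF n] abs_mult mult_ac)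
  qed
  then have f_le: "L2_norm I\<^sub>\<pi> f \<le> \<epsilon> powr (k / (k + 1)) * sqrt (M\<^sup>2 + ((R * \<tau> + 1) / b)\<^sup>2)"
    by (intro source_norm_le[OF eps pos(3) b f gL g_le])
  have "L2_norm I\<^sub>\<pi> g \<le> B2 / D1 * L2_norm I\<^sub>\<pi> f"
  proof (rule L2_norm_le_of_coef_le[OF gL fL])
    fix n :: nat assume n: "1 \<le> n"
    have "0 \<le> b / (real n)\<^sup>2" using b by simp
    then have "\<bar>Phi T a n \<phi>\<bar> \<le> B2 / D1 / (real n)\<^sup>2"
      using Phi\<phi>[OF n] by (simp add: b_def)
    also have "\<dots> \<le> B2 / D1 / 1"
      using n pos by (intro divide_left_mono) (auto simp: one_le_power)
    finally show "\<bar>coef g n\<bar> \<le> B2 / D1 * \<bar>coef f n\<bar>"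
      unfolding gf[OF n] abs_mult by (intro mult_right_mono) auto
  qed (use pos in simp)
  also have "\<dots> \<le> B2 / D1 * M"
    using pos order_trans[OF L2_norm_le_Hs_norm[OF f(1)] f(2)] by (intro mult_left_mono) auto
  finally have "L2_norm I\<^sub>\<pi> g \<le> B2 / D1 * M" .
  moreover have "L2_norm I\<^sub>\<pi> g\<^sub>\<epsilon> \<le> L2_norm I\<^sub>\<pi> (\<lambda>x. g\<^sub>\<epsilon> x - g x) + L2_norm I\<^sub>\<pi> g"
    using L2_norm_triangle[OF L2_diff[OF g\<^sub>\<epsilon> gL] gL] by simp
  ultimately have "\<epsilon> * (\<tau> - 1) \<le> B2 / D1 * M"
    using large noise by (simp add: algebra_simps)
  then show E: "\<epsilon> \<le> E" using pos unfolding E_def by (subst pos_le_divide_eq) auto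
  have R: "0 \<le> R" by (simp add: R_def)
  have "L2_norm I\<^sub>\<pi> ?h \<le> 1 / (2 * \<mu>) * (R * \<tau> * \<epsilon>)"
    using pos g\<^sub>\<epsilon>_le by (intro order_trans[OF tikhonov_norm_le[OF bd g\<^sub>\<epsilon> pos(2)]] mult_left_mono) auto
  also have "\<dots> = 1 / (2 * \<mu>) * (R * \<tau>) * \<epsilon> powr 1"
    using eps by simp
  also have "\<dots> \<le> 1 / (2 * \<mu>) * (R * \<tau>) * (\<epsilon> powr (k / (k + 1)) * E powr (1 - k / (k + 1)))"
    using pos R by (intro mult_left_mono powr_le_powr_mult_bound eps E) auto
  finally have "L2_norm I\<^sub>\<pi> ?h
      \<le> \<epsilon> powr (k / (k + 1)) * (1 / (2 * \<mu>) * (R * \<tau>) * E powr (1 - k / (k + 1)))"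
    by (simp add: mult_ac)
  with f_le show "L2_norm I\<^sub>\<pi> (\<lambda>x. f x - ?h x) \<le> \<epsilon> powr (k / (k + 1)) * P"
    using L2_norm_triangle_diff[OF fL tikhonov_L2_and_coef(1)[OF bd g\<^sub>\<epsilon> pos(2)]]
    unfolding P_def distrib_left by linarith
qed

theorem theorem4p1:
  fixes T \<mu> k \<tau> B1 B2 C1 C2 D1 D2 M :: real
  assumes "T > 0" and "\<mu> > 0" and "k > 0" and "\<tau> > 1" and "M \<ge> 0"
    and "B1 > 0" and "B2 > 0" and "C1 > 0" and "C2 > 0" and "D1 > 0" and "D2 > 0"
  shows "\<exists>P Q :: real. \<forall>(a :: real \<Rightarrow> real) (\<phi> :: real \<Rightarrow> real) (\<phi>\<^sub>\<epsilon> :: real \<Rightarrow> real)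
      (f :: real \<Rightarrow> real) (g :: real \<Rightarrow> real) (g\<^sub>\<epsilon> :: real \<Rightarrow> real) (\<epsilon> :: real).
    continuous_on {0..T} a \<and> continuous_on {0..T} \<phi> \<and> continuous_on {0..T} \<phi>\<^sub>\<epsilon> \<and>
    (\<forall>t\<in>{0..T}. B1 \<le> \<phi> t \<and> \<phi> t \<le> B2) \<and>
    (\<forall>t\<in>{0..T}. C1 \<le> \<phi>\<^sub>\<epsilon> t \<and> \<phi>\<^sub>\<epsilon> t \<le> C2) \<and>
    (\<forall>t\<in>{0..T}. D1 \<le> a t \<and> a t \<le> D2) \<and>
    source_of T a \<phi> f g \<and> g\<^sub>\<epsilon> \<in> L2 I\<^sub>\<pi> \<and>
    \<epsilon> > 0 \<and>
    in_Hs (2 * k) f \<and> Hs_norm (2 * k) f \<le> M \<and>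
    L2_norm I\<^sub>\<pi> (\<lambda>x. g\<^sub>\<epsilon> x - g x) \<le> \<epsilon> \<and>
    L2_norm {0..T} (\<lambda>t. \<phi>\<^sub>\<epsilon> t - \<phi> t) \<le> \<epsilon> \<and>
    0 < \<tau> * \<epsilon> \<and> \<tau> * \<epsilon> < L2_norm I\<^sub>\<pi> g\<^sub>\<epsilon> \<and>
    L2_norm I\<^sub>\<pi> (\<lambda>x. K T a \<phi>\<^sub>\<epsilon> (tikhonov T a \<phi>\<^sub>\<epsilon> g\<^sub>\<epsilon> \<mu>) x - g\<^sub>\<epsilon> x) = \<tau> * \<epsilon>
    \<longrightarrow>
    (0 < k \<and> k \<le> 1 \<longrightarrow>
      L2_norm I\<^sub>\<pi> (\<lambda>x. f x - tikhonov T a \<phi>\<^sub>\<epsilon> g\<^sub>\<epsilon> \<mu> x) \<le> \<epsilon> powr (k / (k + 1)) * P) \<and>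
    (k > 1 \<longrightarrow>
      L2_norm I\<^sub>\<pi> (\<lambda>x. f x - tikhonov T a \<phi>\<^sub>\<epsilon> g\<^sub>\<epsilon> \<mu> x) \<le> \<epsilon> powr (1 / 2) * Q)"
proof -
  define R where "R = 1 + (C2 / D1 / \<mu>)\<^sup>2"
  define b where "b = B1 * (1 - exp (- D2 * T)) / D2"
  define E where "E = B2 / D1 * M / (\<tau> - 1)"
  define P where
    "P = sqrt (M\<^sup>2 + ((R * \<tau> + 1) / b)\<^sup>2) + 1 / (2 * \<mu>) * (R * \<tau>) * E powr (1 - k / (k + 1))"
  note error = tikhonov_discrepancy_error[where M=M, OF assms(1-4) assms(6-11),
      folded R_def b_def E_def, folded P_def]
  have R: "0 \<le> R" by (simp add: R_def)
  have P0: "0 \<le> P" unfolding P_def using assms R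
    by (intro add_nonneg_nonneg mult_nonneg_nonneg) auto
  have weaken: "\<epsilon> powr (k / (k + 1)) * P \<le> \<epsilon> powr (1 / 2) * (E powr (k / (k + 1) - 1 / 2) * P)"
    if "1 < k" "0 < \<epsilon>" "\<epsilon> \<le> E" for \<epsilon>
  proof -
    have "1 / 2 \<le> k / (k + 1)" using that by (simp add: field_simps)
    from mult_right_mono[OF powr_le_powr_mult_bound[OF that(2,3) this] P0]
    show ?thesis by (simp add: mult.assoc)
  qed
  show ?thesis
    by (intro exI[of _ P] exI[of _ "E powr (k / (k + 1) - 1 / 2) * P"] allI impI conjI; elim conjE)
       (blast intro: error, rule order_trans[OF error(2) weaken], (blast intro: error)+)
qed

end
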